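(* Let $q$ be a prime power, let $\phi$ be a monic non-constant irreducible polynomial over $F_q$ of degree $m_\phi$, and let $\lambda$ be a partition. Then $$c_{GL,\phi,q^{m_\phi}}(\lambda)= q^{2m_{\phi}\left[\sum_{h<i} h\, m_h(\lambda) m_i(\lambda) + \frac{1}{2} \sum_i (i-1) m_i(\lambda)^2\right]}\prod_i |GL(m_i(\lambda),q^{m_{\phi}})| = q^{m_{\phi} \sum_i(\lambda'_i)^2} \prod_{i} \left(\frac{1}{q^{m_{\phi}}}\right)_{m_i(\lambda)}.$$
   Context: For a partition $\lambda$, $m_i(\lambda)$ denotes the number of parts of $\lambda$ equal to $i$, and $\lambda_i' = m_i(\lambda)+m_{i+1}(\lambda)+\cdots$ is the $i$th part of the dual (conjugate) partition. Put $$d_i = m_1(\lambda)\cdot 1 + m_2(\lambda)\cdot 2+\cdots+m_{i-1}(\lambda)(i-1) + (m_i(\lambda)+m_{i+1}(\lambda)+\cdots)\, i .$$ Then $$c_{GL,\phi,q^{m_\phi}}(\lambda)=\prod_i\prod_{k=1}^{m_i(\lambda)}\left(q^{m_\phi d_i}-q^{m_\phi(d_i-k)}\right),$$ and $c_{GL,\phi,q^{m_\phi}}(\emptyset)=1$. For $Q>1$ and an integer $r\ge 0$, $\left(\frac1Q\right)_r = \left(1-\frac1Q\right)\left(1-\frac{1}{Q^2}\right)\cdots\left(1-\frac1{Q^r}\right)$. $GL(m,Q)$ is the general linear group of $m\times m$ invertible matrices over the field of $Q$ elements; $|GL(0,Q)|=1$. *)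

theory Defs
  imports
    "HOL-Computational_Algebra.Computational_Algebra"
    "HOL-Number_Theory.Prime_Powers"
    "HOL-Library.Multiset"
    "HOL-Library.Cardinality"
    "Jordan_Normal_Form.Matrix"
begin

text \<open>
  A partition is the finite multiset of its parts, all of which are positive, so that
  the multiplicity of the part \<open>i\<close> is \<^term>\<open>count \<mu> i\<close>.
\<close>

definition is_partition :: "nat multiset \<Rightarrow> bool" where
  "is_partition \<mu> \<longleftrightarrow> 0 \<notin># \<mu>"

text \<open>
  The index \<open>i\<close> of sums and products over part sizes runs over all positive integers. Beyond the
  largest part all multiplicities and all parts of the conjugate vanish, so every summand is \<open>0\<close>
  and every factor is \<open>1\<close> there. We therefore let \<open>i\<close> range from \<open>1\<close> to the largest part,
  which is taken to be \<open>0\<close> for the empty partition.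
\<close>

definition largest_part :: "nat multiset \<Rightarrow> nat" where
  "largest_part \<mu> = Max (insert 0 (set_mset \<mu>))"

definition conj_part :: "nat multiset \<Rightarrow> nat \<Rightarrow> nat" where
  "conj_part \<mu> i = (\<Sum>j = i..largest_part \<mu>. count \<mu> j)"

definition d_exp :: "nat multiset \<Rightarrow> nat \<Rightarrow> nat" where
  "d_exp \<mu> i = (\<Sum>j = 1..<i. count \<mu> j * j) + conj_part \<mu> i * i"

text \<open>
  The exponent \<open>d_exp \<mu> i - k\<close> is never truncated: for \<open>1 \<le> i\<close> and
  \<open>k \<le> count \<mu> i\<close> one has \<open>k \<le> d_exp \<mu> i\<close>.
\<close>

definition c_GL :: "nat \<Rightarrow> 'a::field poly \<Rightarrow> nat multiset \<Rightarrow> real" where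
  "c_GL q \<phi> \<mu> =
     (\<Prod>i = 1..largest_part \<mu>. \<Prod>k = 1..count \<mu> i.
        real q ^ (degree \<phi> * d_exp \<mu> i) - real q ^ (degree \<phi> * (d_exp \<mu> i - k)))"

lemma c_GL_empty: "c_GL q \<phi> {#} = 1"
  by (simp add: c_GL_def largest_part_def)

text \<open>The symbol \<open>(1/Q)\<^sub>r\<close>, as a function of \<open>Q\<close> and \<open>r\<close>.\<close>

definition inv_poch :: "real \<Rightarrow> nat \<Rightarrow> real" where
  "inv_poch Q r = (\<Prod>j = 1..r. 1 - 1 / Q ^ j)"

definition GL :: "nat \<Rightarrow> 'k::field mat set" where
  "GL m = {A \<in> carrier_mat m m. invertible_mat A}"

lemma card_GL_0: "card (GL 0 :: 'k::field mat set) = 1"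
proof -
  have "(GL 0 :: 'k mat set) = {1\<^sub>m 0}"
    by (auto simp: GL_def invertible_mat_def inverts_mat_def intro!: exI[of _ "1\<^sub>m 0"])
  then show ?thesis by simp
qed

end

theory Submission
  imports Defs "Jordan_Normal_Form.Determinant"
begin

text \<open>
  All three expressions are a power of \<open>Q = q\<^sup>m\<close>, where \<open>m = deg \<phi>\<close>, times
  \<open>\<Prod>\<^sub>i (1/Q)\<^bsub>m_i\<^esub>\<close>. Since \<open>d_i = \<Sum>\<^sub>j m_j min i j\<close>, the three exponents are
  evaluations of the quadratic form \<open>\<Sum>\<^sub>i \<Sum>\<^sub>j m_i m_j min i j\<close>: directly, after splitting
  along the diagonal, and after writing \<open>min i j\<close> as the number of \<open>l\<close> with \<open>1 \<le> l \<le> i, j\<close>.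
  The order of the general linear group comes from fibring it over the first column of a matrix.
\<close>

section \<open>The order of the general linear group\<close>

text \<open>With this criterion, triangular, row-swapped and block matrices are recognised as
  members of \<open>GL\<close> without exhibiting inverses.\<close>

lemma invertible_mat_iff_det:
  fixes A :: "'k::field mat"
  assumes A: "A \<in> carrier_mat n n"
  shows "invertible_mat A \<longleftrightarrow> det A \<noteq> 0"
proof
  assume "invertible_mat A"
  then obtain B where "inverts_mat A B" "inverts_mat B A"
    unfolding invertible_mat_def by blast
  then have AB: "A * B = 1\<^sub>m n" and BA: "B * A = 1\<^sub>m (dim_row B)"
    using A by (simp_all add: inverts_mat_def)
  \<comment> \<open>\<open>inverts_mat\<close> does not fix the shape of \<open>B\<close>; both
    dimensions are read off from the two product equations.\<close>
  have B: "B \<in> carrier_mat n n"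
    using arg_cong[OF AB, of dim_col] arg_cong[OF BA, of dim_col] A by auto
  have "det A * det B = 1"
    using arg_cong[OF AB, of det] det_mult[OF A B] by simp
  then show "det A \<noteq> 0" by auto
next
  assume "det A \<noteq> 0"
  from det_non_zero_imp_unit[OF A this, of "()"]
  obtain B where "B \<in> carrier_mat n n" "B * A = 1\<^sub>m n" "A * B = 1\<^sub>m n"
    unfolding Units_def ring_mat_simps by blast
  then have "inverts_mat A B \<and> inverts_mat B A" using A by (simp add: inverts_mat_def)
  then show "invertible_mat A"
    using A unfolding invertible_mat_def by (intro conjI exI[of _ B]) simp_all
qed

lemma GL_det: "GL n = {A \<in> carrier_mat n n. det A \<noteq> (0::'k::field)}"
  unfolding GL_def by (auto simp: invertible_mat_iff_det)

lemma GL_mult: "A \<in> GL n \<Longrightarrow> B \<in> GL n \<Longrightarrow> A * B \<in> GL n"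
  unfolding GL_det by (auto simp: det_mult)

lemma GL_inverse:
  assumes "A \<in> GL n"
  obtains B where "B \<in> GL n" "A * B = 1\<^sub>m n" "B * A = 1\<^sub>m n"
proof -
  have A: "A \<in> carrier_mat n n" "det A \<noteq> 0" using assms by (auto simp: GL_det)
  from det_non_zero_imp_unit[OF A, of "()"]
  obtain B where B: "B \<in> carrier_mat n n" "B * A = 1\<^sub>m n" "A * B = 1\<^sub>m n"
    unfolding Units_def ring_mat_simps by blast
  have "det A * det B = 1"
    using arg_cong[OF B(3), of det] det_mult[OF A(1) B(1)] by simp
  then have "B \<in> GL n" using B(1) by (auto simp: GL_det)
  with B that show thesis by blast
qed

section \<open>Counting vectors over a finite field\<close>

lemma bij_betw_list_of_vec:
  "bij_betw list_of_vec (carrier_vec n) {xs. set xs \<subseteq> UNIV \<and> length xs = n}"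
proof (rule bij_betw_byWitness[where f' = vec_of_list])
  show "list_of_vec ` carrier_vec n \<subseteq> {xs. set xs \<subseteq> UNIV \<and> length xs = n}"
    by (auto simp only: length_list_of_vec carrier_vec_def)
  show "vec_of_list ` {xs. set xs \<subseteq> UNIV \<and> length xs = n} \<subseteq> carrier_vec n"
    by (auto simp only: dim_vec_of_list carrier_vec_def)
qed (simp_all add: vec_list list_vec)

lemma finite_carrier_vec: "finite (carrier_vec n :: 'k::finite vec set)"
  unfolding bij_betw_finite[OF bij_betw_list_of_vec] by (rule finite_lists_length_eq) simp

lemma card_carrier_vec: "card (carrier_vec n :: 'k::finite vec set) = CARD('k) ^ n"
  unfolding bij_betw_same_card[OF bij_betw_list_of_vec] by (rule card_lists_length_eq) simp

section \<open>Fibring \<open>GL n\<close> over the first column\<close>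

text \<open>Once a nonzero entry of \<open>v\<close> is moved to the top, the permuted vector is the
  first column of a lower triangular matrix whose other diagonal entries are 1; a row swap then
  restores \<open>v\<close>.\<close>

lemma GL_transitive:
  fixes v :: "'k::field vec"
  assumes v: "v \<in> carrier_vec n" "v \<noteq> 0\<^sub>v n"
  obtains P where "P \<in> GL n" "col P 0 = v"
proof -
  have "\<exists>i<n. v $ i \<noteq> 0"
  proof (rule ccontr)
    assume "\<not> ?thesis"
    then have "v = 0\<^sub>v n" using v(1) by (intro eq_vecI) auto
    with v(2) show False ..
  qed
  then obtain i where i: "i < n" "v $ i \<noteq> 0" by blast
  \<comment> \<open>\<open>s\<close> is the transposition of 0 and \<open>i\<close>, so the diagonal
    of \<open>L\<close> starts with \<open>v $ i\<close>.\<close>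
  define s where "s r = (if r = 0 then i else if r = i then 0 else r)" for r
  define L where "L = mat n n (\<lambda>(r, c). if c = 0 then v $ s r else if r = c then 1 else 0)"
  have L: "L \<in> carrier_mat n n" by (simp add: L_def)
  have "det L = prod_list (diag_mat L)"
    by (rule det_lower_triangular[OF _ L]) (auto simp: L_def)
  also have "\<dots> \<noteq> 0"
    using i by (auto simp: prod_list_diag_prod L_def s_def)
  finally have L0: "det L \<noteq> 0" .
  \<comment> \<open>The case \<open>i = 0\<close> is separate because \<open>det_swaprows\<close> is
    about two distinct rows.\<close>
  define P where "P = (if i = 0 then L else swaprows 0 i L)"
  have "P \<in> GL n"
    using L L0 i det_swaprows[OF _ i(1) _ L, of 0] by (simp add: GL_det P_def)
  moreover have "col P 0 = v"
    using i v by (intro eq_vecI) (auto simp: P_def L_def s_def)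
  ultimately show thesis using that by blast
qed

text \<open>Left multiplication by an invertible \<open>P\<close> with first column \<open>v\<close>
  carries the fibre over the first unit vector onto the fibre over \<open>v\<close>; multiplication
  by the inverse \<open>R\<close> undoes it.\<close>

lemma card_GL_fibre:
  fixes v :: "'k::{field,finite} vec"
  assumes v: "v \<in> carrier_vec n" "v \<noteq> 0\<^sub>v n"
  shows "card {A \<in> GL n. col A 0 = v} = card {A \<in> GL n. col A 0 = (unit_vec n 0 :: 'k vec)}"
proof -
  have n: "0 < n" using v by (cases n) auto
  obtain P where P: "P \<in> GL n" "col P 0 = v" using GL_transitive[OF v] .
  obtain R where R: "R \<in> GL n" "P * R = 1\<^sub>m n" "R * P = 1\<^sub>m n" using GL_inverse[OF P(1)] .
  have Pc: "P \<in> carrier_mat n n" and Rc: "R \<in> carrier_mat n n"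
    using P R by (auto simp: GL_def)
  have Pe: "P *\<^sub>v unit_vec n 0 = v"
    using P(2) col_mult2[OF Pc one_carrier_mat n] n Pc by simp
  have "R *\<^sub>v v = (R * P) *\<^sub>v unit_vec n 0"
    unfolding Pe[symmetric] by (rule assoc_mult_mat_vec[symmetric, OF Rc Pc]) simp
  then have Rv: "R *\<^sub>v v = unit_vec n 0" using R(3) by simp
  have "bij_betw ((*) P) {A \<in> GL n. col A 0 = (unit_vec n 0 :: 'k vec)} {A \<in> GL n. col A 0 = v}"
  proof (rule bij_betw_byWitness[where f' = "(*) R"])
    show "\<forall>A\<in>{A \<in> GL n. col A 0 = unit_vec n 0}. R * (P * A) = A"
      using assoc_mult_mat[OF Rc Pc] unfolding R(3) GL_def by fastforce
    show "\<forall>A\<in>{A \<in> GL n. col A 0 = v}. P * (R * A) = A"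
      using assoc_mult_mat[OF Pc Rc] unfolding R(2) GL_def by fastforce
    show "(*) P ` {A \<in> GL n. col A 0 = unit_vec n 0} \<subseteq> {A \<in> GL n. col A 0 = v}"
      using GL_mult[OF P(1)] Pe n col_mult2[OF Pc] by (auto simp: GL_def)
    show "(*) R ` {A \<in> GL n. col A 0 = v} \<subseteq> {A \<in> GL n. col A 0 = unit_vec n 0}"
      using GL_mult[OF R(1)] Rv n col_mult2[OF Rc] by (auto simp: GL_def)
  qed
  then show ?thesis by (rule bij_betw_same_card[symmetric])
qed

text \<open>Such a matrix is block upper triangular with corner 1: the rest of the first row is
  free, and the determinant is that of the lower right block.\<close>

lemma bij_betw_GL_unit_fibre:
  "bij_betw (\<lambda>(r, B). four_block_mat (1\<^sub>m 1) (mat_of_row r) (0\<^sub>m n 1) B)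
     (carrier_vec n \<times> GL n) {A \<in> GL (Suc n). col A 0 = (unit_vec (Suc n) 0 :: 'k::field vec)}"
proof -
  let ?F = "\<lambda>(r, B). four_block_mat (1\<^sub>m 1) (mat_of_row r) (0\<^sub>m n 1) B :: 'k mat"
  let ?G = "\<lambda>A :: 'k mat. (vec n (\<lambda>j. A $$ (0, Suc j)), mat n n (\<lambda>(i, j). A $$ (Suc i, Suc j)))"
  have block: "?F (r, B) \<in> carrier_mat (Suc n) (Suc n)" "col (?F (r, B)) 0 = unit_vec (Suc n) 0"
    "det (?F (r, B)) = det B" if "r \<in> carrier_vec n" "B \<in> carrier_mat n n" for r B
    using that det_four_block_mat_lower_left_zero[of "1\<^sub>m 1 :: 'k mat" 1 "mat_of_row r" n _ B]
    by (auto simp: mat_of_row_carrier intro!: eq_vecI)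
  have FG: "?F (?G A) = A" if "A \<in> carrier_mat (Suc n) (Suc n)" "col A 0 = unit_vec (Suc n) 0" for A
  proof -
    have c: "A $$ (i, 0) = (if i = 0 then 1 else 0)" if "i < Suc n" for i
      using arg_cong[OF \<open>col A 0 = _\<close>, of "\<lambda>v. vec_index v i"] \<open>A \<in> _\<close> that by auto
    show ?thesis
      using that(1) by (intro eq_matI) (auto simp: c mat_of_row_def)
  qed
  show ?thesis
  proof (rule bij_betw_byWitness[where f' = ?G])
    show "\<forall>p\<in>carrier_vec n \<times> GL n. ?G (?F p) = p"
      by (auto simp: GL_def mat_of_row_def intro!: eq_vecI eq_matI)
    show "\<forall>A\<in>{A \<in> GL (Suc n). col A 0 = unit_vec (Suc n) 0}. ?F (?G A) = A"
      using FG by (auto simp: GL_def)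
    show "?F ` (carrier_vec n \<times> GL n) \<subseteq> {A \<in> GL (Suc n). col A 0 = unit_vec (Suc n) 0}"
    proof (rule image_subsetI)
      fix p :: "'k vec \<times> 'k mat" assume "p \<in> carrier_vec n \<times> GL n"
      then obtain r B where p: "p = (r, B)" "r \<in> carrier_vec n" "B \<in> carrier_mat n n" "det B \<noteq> 0"
        by (auto simp: GL_det)
      show "?F p \<in> {A \<in> GL (Suc n). col A 0 = unit_vec (Suc n) 0}"
        unfolding GL_det p(1) using block[OF p(2,3)] p(4) by simp
    qed
    show "?G ` {A \<in> GL (Suc n). col A 0 = unit_vec (Suc n) 0} \<subseteq> carrier_vec n \<times> GL n"
    proof (rule image_subsetI)
      fix A :: "'k mat" assume A: "A \<in> {A \<in> GL (Suc n). col A 0 = unit_vec (Suc n) 0}"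
      then have "det (snd (?G A)) = det (?F (?G A))"
        using block(3)[of "fst (?G A)" "snd (?G A)"] by simp
      also have "\<dots> = det A" using FG A by (auto simp: GL_def)
      finally show "?G A \<in> carrier_vec n \<times> GL n" using A by (auto simp: GL_det)
    qed
  qed
qed

text \<open>Induction on \<open>n\<close>: there are \<open>Q ^ Suc n - 1\<close> possible first
  columns, and each fibre has \<open>Q ^ n\<close> times as many elements as \<open>GL n\<close>.
  Finiteness is carried along because \<open>card\<close> is 0 on infinite sets.\<close>

lemma finite_card_GL:
  "finite (GL n :: 'k::{field,finite} mat set) \<and>
   real (card (GL n :: 'k mat set)) = real CARD('k) ^ n\<^sup>2 * inv_poch (real CARD('k)) n"
proof (induction n)
  case 0
  have "card (GL 0 :: 'k mat set) = 1" by (rule card_GL_0)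
  moreover from this have "finite (GL 0 :: 'k mat set)" by (intro card_ge_0_finite) simp
  ultimately show ?case by (simp add: inv_poch_def)
next
  case (Suc n)
  let ?Q = "CARD('k)"
  let ?E = "{A \<in> GL (Suc n). col A 0 = (unit_vec (Suc n) 0 :: 'k vec)}"
  let ?V = "carrier_vec (Suc n) - {0\<^sub>v (Suc n) :: 'k vec}"
  have cE: "card ?E = ?Q ^ n * card (GL n :: 'k mat set)"
    using bij_betw_same_card[OF bij_betw_GL_unit_fibre[of n, where ?'k = 'k]]
    by (simp add: card_cartesian_product card_carrier_vec)
  have fV: "finite ?V" by (simp add: finite_carrier_vec)
  have cV: "card ?V = ?Q ^ Suc n - 1"
    by (subst card_Diff_singleton) (auto simp: card_carrier_vec)
  have Q: "?Q > 0" by simp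
  \<comment> \<open>The inverse of \<open>A\<close> sends the first column to a unit vector, so that
    column is not zero.\<close>
  have nz: "col A 0 \<in> ?V" if A: "A \<in> GL (Suc n)" for A :: "'k mat"
  proof -
    obtain B where B: "B \<in> GL (Suc n)" "B * A = 1\<^sub>m (Suc n)" using GL_inverse[OF A] by metis
    have Ac: "A \<in> carrier_mat (Suc n) (Suc n)" and Bc: "B \<in> carrier_mat (Suc n) (Suc n)"
      using A B by (auto simp: GL_def)
    have "B *\<^sub>v col A 0 = unit_vec (Suc n) 0"
      using col_mult2[OF Bc Ac, of 0] B(2) by simp
    moreover have "B *\<^sub>v 0\<^sub>v (Suc n) = 0\<^sub>v (Suc n)"
      using Bc by (intro eq_vecI) auto
    ultimately have "col A 0 \<noteq> 0\<^sub>v (Suc n)"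
      using unit_vec_nonzero[OF zero_less_Suc, of n, where ?'a = 'k, THEN not_sym] by auto
    moreover have "col A 0 \<in> carrier_vec (Suc n)"
      using Ac by (intro carrier_vecI) simp
    ultimately show ?thesis by simp
  qed
  then have U: "(GL (Suc n) :: 'k mat set) = (\<Union>v\<in>?V. {A \<in> GL (Suc n). col A 0 = v})" by auto
  have fE: "finite ?E"
    using bij_betw_finite[OF bij_betw_GL_unit_fibre[of n, where ?'k = 'k]] Suc.IH
    by (simp add: finite_carrier_vec)
  have fib: "card {A \<in> GL (Suc n). col A 0 = v} = card ?E" if "v \<in> ?V" for v
    using card_GL_fibre that by auto
  have pos: "card (GL n :: 'k mat set) > 0"
  proof -
    have "(1\<^sub>m n :: 'k mat) \<in> GL n" by (simp add: GL_det)
    then show ?thesis using Suc.IH card_gt_0_iff by blast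
  qed
  \<comment> \<open>A set of positive cardinality is finite, so finiteness of a fibre follows from
    its count.\<close>
  have ffib: "finite {A \<in> GL (Suc n). col A 0 = v}" if "v \<in> ?V" for v
    using fib[OF that] cE pos Q by (intro card_ge_0_finite) simp
  have "card (GL (Suc n) :: 'k mat set) = (\<Sum>v\<in>?V. card {A \<in> GL (Suc n). col A 0 = v})"
    by (subst U, rule card_UN_disjoint) (use fV ffib in auto)
  also have "\<dots> = (?Q ^ Suc n - 1) * (?Q ^ n * card (GL n :: 'k mat set))"
    using fib cV cE by simp
  finally have "real (card (GL (Suc n) :: 'k mat set)) =
      (real ?Q ^ Suc n - 1) * (real ?Q ^ n * real (card (GL n :: 'k mat set)))"
    using Q by (simp add: of_nat_diff)
  \<comment> \<open>Extracting \<open>?Q ^ Suc n\<close> from the first factor leaves the last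
    factor of \<open>inv_poch\<close> at \<open>Suc n\<close>.\<close>
  also have "\<dots> = real ?Q ^ (Suc n + n + n\<^sup>2) * ((1 - 1 / real ?Q ^ Suc n) * inv_poch (real ?Q) n)"
    using Suc.IH Q by (simp add: power_add field_simps)
  also have "Suc n + n + n\<^sup>2 = (Suc n)\<^sup>2" by (simp add: power2_eq_square)
  also have "(1 - 1 / real ?Q ^ Suc n) * inv_poch (real ?Q) n = inv_poch (real ?Q) (Suc n)"
    by (simp add: inv_poch_def)
  finally have "real (card (GL (Suc n) :: 'k mat set)) =
      real ?Q ^ (Suc n)\<^sup>2 * inv_poch (real ?Q) (Suc n)" .
  moreover have "finite (GL (Suc n) :: 'k mat set)"
    by (subst U) (use fV ffib in auto)
  ultimately show ?case by blast
qed

lemmas card_GL = finite_card_GL[THEN conjunct2]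

section \<open>The quadratic form in the multiplicities\<close>

text \<open>The square of indices splits into its diagonal and two mirror triangles; the induction
  adds the last row and column.\<close>

lemma sum_symmetric:
  fixes f :: "nat \<Rightarrow> nat \<Rightarrow> 'b::comm_semiring_1"
  assumes "\<And>i j. f i j = f j i"
  shows "(\<Sum>i = 1..N. \<Sum>j = 1..N. f i j) =
    2 * (\<Sum>i = 1..N. \<Sum>h = 1..<i. f h i) + (\<Sum>i = 1..N. f i i)"
proof (induction N)
  case (Suc N)
  have "(\<Sum>j = 1..N. f (Suc N) j) = (\<Sum>h = 1..<Suc N. f h (Suc N))"
    using assms by (simp add: atLeastLessThanSuc_atLeastAtMost)
  with Suc show ?case
    by (simp add: sum.distrib algebra_simps mult_2 atLeastLessThanSuc_atLeastAtMost)
qed simp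

text \<open>The range splits at \<open>i\<close>: the minimum is \<open>j\<close> below it and
  \<open>i\<close> from there on.\<close>

lemma d_exp_min:
  assumes "1 \<le> i" "i \<le> largest_part \<mu>"
  shows "d_exp \<mu> i = (\<Sum>j = 1..largest_part \<mu>. count \<mu> j * min i j)"
proof -
  let ?N = "largest_part \<mu>"
  have "{1..?N} = {1..<i} \<union> {i..?N}" using assms by auto
  then have "(\<Sum>j = 1..?N. count \<mu> j * min i j) =
      (\<Sum>j = 1..<i. count \<mu> j * min i j) + (\<Sum>j = i..?N. count \<mu> j * min i j)"
    by (simp add: sum.union_disjoint ivl_disj_int)
  also have "\<dots> = d_exp \<mu> i"
    unfolding d_exp_def conj_part_def sum_distrib_right
    by (intro arg_cong2[where f = "(+)"] sum.cong) auto
  finally show ?thesis ..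
qed

text \<open>Expand the squares and sum over \<open>l\<close> first: the indices \<open>l\<close>
  below both \<open>i\<close> and \<open>j\<close> (inclusive) number
  \<open>min i j\<close>.\<close>

lemma sum_conj_part_power2:
  "(\<Sum>l = 1..largest_part \<mu>. (conj_part \<mu> l)\<^sup>2) =
   (\<Sum>i = 1..largest_part \<mu>. count \<mu> i * d_exp \<mu> i)"
proof -
  let ?N = "largest_part \<mu>" and ?m = "count \<mu>"
  \<comment> \<open>An indicator gives all inner sums the same range, so that they can be
    interchanged.\<close>
  have c: "conj_part \<mu> l = (\<Sum>i = 1..?N. if l \<le> i then ?m i else 0)" if "l \<in> {1..?N}" for l
    unfolding conj_part_def using that by (intro sum.mono_neutral_cong_left) auto
  have "(\<Sum>l = 1..?N. (conj_part \<mu> l)\<^sup>2) =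
      (\<Sum>l = 1..?N. \<Sum>i = 1..?N. \<Sum>j = 1..?N. if l \<le> min i j then ?m i * ?m j else 0)"
    by (rule sum.cong) (auto simp: c power2_eq_square sum_product intro!: sum.cong)
  also have "\<dots> = (\<Sum>i = 1..?N. \<Sum>j = 1..?N. \<Sum>l = 1..?N. if l \<le> min i j then ?m i * ?m j else 0)"
    by (subst sum.swap, rule sum.cong[OF refl], rule sum.swap)
  also have "\<dots> = (\<Sum>i = 1..?N. \<Sum>j = 1..?N. ?m i * (?m j * min i j))"
  proof (intro sum.cong refl)
    fix i j assume ij: "i \<in> {1..?N}" "j \<in> {1..?N}"
    have "(\<Sum>l = 1..?N. if l \<le> min i j then ?m i * ?m j else 0) = (\<Sum>l = 1..min i j. ?m i * ?m j)"
      using ij by (intro sum.mono_neutral_cong_right) auto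
    then show "(\<Sum>l = 1..?N. if l \<le> min i j then ?m i * ?m j else 0) = ?m i * (?m j * min i j)"
      by simp
  qed
  also have "\<dots> = (\<Sum>i = 1..?N. ?m i * d_exp \<mu> i)"
    by (intro sum.cong refl) (simp add: d_exp_min sum_distrib_left)
  finally show ?thesis .
qed

text \<open>Off the diagonal \<open>min h i = h\<close> for \<open>h < i\<close>; on it the minimum
  is \<open>i\<close>.\<close>

lemma sum_count_d_exp:
  "(\<Sum>i = 1..largest_part \<mu>. count \<mu> i * d_exp \<mu> i) =
   2 * (\<Sum>i = 1..largest_part \<mu>. \<Sum>h = 1..<i. h * count \<mu> h * count \<mu> i)
   + (\<Sum>i = 1..largest_part \<mu>. i * (count \<mu> i)\<^sup>2)"
proof -
  let ?N = "largest_part \<mu>" and ?m = "count \<mu>"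
  have "(\<Sum>i = 1..?N. ?m i * d_exp \<mu> i) = (\<Sum>i = 1..?N. \<Sum>j = 1..?N. ?m i * ?m j * min i j)"
    by (intro sum.cong refl) (simp add: d_exp_min sum_distrib_left mult.assoc)
  also have "\<dots> = 2 * (\<Sum>i = 1..?N. \<Sum>h = 1..<i. ?m h * ?m i * min h i)
      + (\<Sum>i = 1..?N. ?m i * ?m i * min i i)"
    by (rule sum_symmetric) (simp add: min.commute)
  also have "(\<Sum>i = 1..?N. \<Sum>h = 1..<i. ?m h * ?m i * min h i) =
      (\<Sum>i = 1..?N. \<Sum>h = 1..<i. h * ?m h * ?m i)"
    by (intro sum.cong refl) auto
  also have "(\<Sum>i = 1..?N. ?m i * ?m i * min i i) = (\<Sum>i = 1..?N. i * (?m i)\<^sup>2)"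
    by (intro sum.cong refl) (simp add: power2_eq_square)
  finally show ?thesis .
qed

section \<open>The three expressions\<close>

text \<open>Each factor contributes \<open>Q ^ d\<close>; the bound \<open>m \<le> d\<close> keeps
  \<open>d - k\<close> from being truncated.\<close>

lemma prod_power_diff:
  assumes "Q \<noteq> 0" "m \<le> d"
  shows "(\<Prod>k = 1..m. Q ^ d - Q ^ (d - k)) = Q ^ (m * d) * inv_poch Q m"
proof -
  have "(\<Prod>k = 1..m. Q ^ d - Q ^ (d - k)) = (\<Prod>k = 1..m. Q ^ d * (1 - 1 / Q ^ k))"
    using assms by (intro prod.cong) (auto simp: power_diff algebra_simps)
  then show ?thesis
    by (simp add: prod.distrib inv_poch_def power_mult[symmetric] mult.commute)
qed

text \<open>This is the common normal form: after it, both identities of the theorem reduce to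
  comparing exponents of \<open>q\<close>.\<close>

lemma c_GL_eq:
  assumes "q > 0"
  shows "c_GL q \<phi> \<mu> =
    (real q ^ degree \<phi>) ^ (\<Sum>i = 1..largest_part \<mu>. count \<mu> i * d_exp \<mu> i)
    * (\<Prod>i = 1..largest_part \<mu>. inv_poch (real q ^ degree \<phi>) (count \<mu> i))"
proof -
  let ?N = "largest_part \<mu>" and ?Q = "real q ^ degree \<phi>"
  have "(\<Prod>k = 1..count \<mu> i.
        real q ^ (degree \<phi> * d_exp \<mu> i) - real q ^ (degree \<phi> * (d_exp \<mu> i - k))) =
      ?Q ^ (count \<mu> i * d_exp \<mu> i) * inv_poch ?Q (count \<mu> i)" if i: "i \<in> {1..?N}" for i
    unfolding power_mult[of "real q" "degree \<phi>"]
  proof (rule prod_power_diff)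
    show "?Q \<noteq> 0" using assms by simp
    have "count \<mu> i \<le> conj_part \<mu> i"
      unfolding conj_part_def using i by (intro member_le_sum) auto
    also have "\<dots> \<le> conj_part \<mu> i * i" using i by simp
    also have "\<dots> \<le> d_exp \<mu> i" by (simp add: d_exp_def)
    finally show "count \<mu> i \<le> d_exp \<mu> i" .
  qed
  then show ?thesis
    unfolding c_GL_def power_sum prod.distrib[symmetric] by (intro prod.cong refl)
qed

theorem theorem2:
  fixes q :: nat
    and \<phi> :: "'a::{field,finite} poly"
    and \<mu> :: "nat multiset"
  assumes "primepow q" and "CARD('a) = q"
    and "lead_coeff \<phi> = 1" and "degree \<phi> > 0" and "irreducible \<phi>"
    and "is_partition \<mu>"
  shows "(CARD('k::{field,finite}) = q ^ degree \<phi> \<longrightarrow>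
           c_GL q \<phi> \<mu> =
             real q powr (2 * real (degree \<phi>) *
               ((\<Sum>i = 1..largest_part \<mu>. \<Sum>h = 1..<i. real h * real (count \<mu> h) * real (count \<mu> i))
                + 1 / 2 * (\<Sum>i = 1..largest_part \<mu>. (real i - 1) * real (count \<mu> i) ^ 2)))
             * (\<Prod>i = 1..largest_part \<mu>. real (card (GL (count \<mu> i) :: 'k mat set))))
       \<and> c_GL q \<phi> \<mu> =
             real q ^ (degree \<phi> * (\<Sum>i = 1..largest_part \<mu>. conj_part \<mu> i ^ 2))
             * (\<Prod>i = 1..largest_part \<mu>. inv_poch (real q ^ degree \<phi>) (count \<mu> i))"
proof (intro conjI impI)
  let ?N = "largest_part \<mu>" and ?Q = "real q ^ degree \<phi>" and ?m = "count \<mu>"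
  let ?S = "\<Sum>i = 1..?N. \<Sum>h = 1..<i. real h * real (?m h) * real (?m i)"
  let ?T = "\<Sum>i = 1..?N. (real i - 1) * real (?m i) ^ 2"
  let ?D = "\<Sum>i = 1..?N. ?m i * d_exp \<mu> i" and ?M = "\<Sum>i = 1..?N. (?m i)\<^sup>2"
  have q: "q > 0" using assms(2) by auto
  show "c_GL q \<phi> \<mu> = real q ^ (degree \<phi> * (\<Sum>i = 1..?N. conj_part \<mu> i ^ 2))
      * (\<Prod>i = 1..?N. inv_poch ?Q (?m i))"
    unfolding c_GL_eq[OF q] sum_conj_part_power2 power_mult ..
  assume card: "CARD('k) = q ^ degree \<phi>"
  have "real ?D = 2 * ?S + (\<Sum>i = 1..?N. real i * real (?m i) ^ 2)"
    unfolding sum_count_d_exp by simp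
  \<comment> \<open>Writing \<open>i\<close> as \<open>(i - 1) + 1\<close> splits off
    \<open>?M\<close>, the total exponent that the orders of the groups \<open>GL (?m i)\<close>
    account for.\<close>
  also have "(\<Sum>i = 1..?N. real i * real (?m i) ^ 2) = ?T + real ?M"
    by (simp add: sum.distrib[symmetric] algebra_simps)
  finally have D: "real (degree \<phi> * ?D) = 2 * real (degree \<phi>) * (?S + 1 / 2 * ?T) + real (degree \<phi> * ?M)"
    by (simp add: algebra_simps)
  \<comment> \<open>The exponent in the claim is a real expression with the factor 1/2, hence the
    passage to \<open>powr\<close>, valid as \<open>q\<close> is positive.\<close>
  have "?Q ^ ?D = real q powr real (degree \<phi> * ?D)"
    by (subst powr_realpow) (use q in \<open>simp_all only: power_mult of_nat_0_less_iff\<close>)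
  also have "\<dots> = real q powr (2 * real (degree \<phi>) * (?S + 1 / 2 * ?T)) * ?Q ^ ?M"
    unfolding D powr_add using q by (simp only: powr_realpow power_mult of_nat_0_less_iff)
  also have "?Q ^ ?M = (\<Prod>i = 1..?N. ?Q ^ (?m i)\<^sup>2)"
    by (simp add: power_sum)
  finally show "c_GL q \<phi> \<mu> = real q powr (2 * real (degree \<phi>) * (?S + 1 / 2 * ?T))
      * (\<Prod>i = 1..?N. real (card (GL (?m i) :: 'k mat set)))"
    unfolding c_GL_eq[OF q] card_GL card by (simp add: prod.distrib)
qed

end
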